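(* Let $q$ be a complex number with $|q|<1$. Then $$\sum_{n=0}^{\infty}q^n(q^{n+1};q)_n(q^{2n+2};q^2)_{\infty}=\sum_{j=0}^{\infty}(-1)^jq^{j(3j+2)}(1+q^{2j+1}).$$
   Context: Notation: $(a;q)_n:=\prod_{j=0}^{n-1}(1-aq^j)$ for $n\ge 0$ (empty product equal to 1) and $(a;q)_\infty:=\lim_{n\to\infty}(a;q)_n$. *)

theory Defs
  imports "HOL-Analysis.Analysis"
begin

definition qpoch :: "complex \<Rightarrow> complex \<Rightarrow> nat \<Rightarrow> complex" where
  "qpoch a q n = (\<Prod>j<n. 1 - a * q ^ j)"

definition qpoch_inf :: "complex \<Rightarrow> complex \<Rightarrow> complex" where
  "qpoch_inf a q = lim (\<lambda>n. qpoch a q n)"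

(* The limit defining qpoch_inf exists whenever |q| < 1, so its value is meaningful there. *)
lemma qpoch_LIMSEQ:
  assumes "norm q < 1"
  shows "(\<lambda>n. qpoch a q n) \<longlonglongrightarrow> qpoch_inf a q"
proof -
  have "summable (\<lambda>j. norm a * norm q ^ j)"
    using assms by (intro summable_mult summable_geometric) simp
  then have "summable (\<lambda>j. norm ((1 - a * q ^ j) - 1))"
    by (simp add: norm_mult norm_power)
  then have "convergent_prod (\<lambda>j. 1 - a * q ^ j)"
    by (intro abs_convergent_prod_imp_convergent_prod)
       (simp add: abs_convergent_prod_conv_summable)
  then have "convergent (\<lambda>n. \<Prod>j\<le>n. 1 - a * q ^ j)"
    by (rule convergent_prod_imp_convergent)
  then have "convergent (\<lambda>n. qpoch a q (Suc n))"
    by (simp add: qpoch_def lessThan_Suc_atMost)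
  then have "convergent (\<lambda>n. qpoch a q n)"
    by (subst (asm) convergent_Suc_iff)
  then show ?thesis
    by (simp add: qpoch_inf_def convergent_LIMSEQ_iff)
qed

end

theory Submission
  imports Defs
begin

text \<open>
  Writing the summand as \<open>(q;q)\<^sub>\<infinity> q\<^sup>n / ((q;q)\<^sub>n (q\<^sup>2\<^sup>n\<^sup>+\<^sup>1;q\<^sup>2)\<^sub>\<infinity>)\<close> and expanding the last factor by
  Euler's formula \<open>1 / (z;q)\<^sub>\<infinity> = \<Sum> z\<^sup>m / (q;q)\<^sub>m\<close> gives a double series; summing over \<open>n\<close> first, again
  by Euler's formula, turns the left-hand side into \<open>\<Sum> (q;q\<^sup>2)\<^sub>m q\<^sup>m\<close>. The Fine functions
  \<open>f a t = \<Sum> (a;Q)\<^sub>n t\<^sup>n\<close> satisfy a contiguous relation between \<open>f a t\<close> and \<open>f (a Q) (t Q)\<close>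
  whose iteration from \<open>a = t = q\<close>, \<open>Q = q\<^sup>2\<close> is the false theta series on the right.
\<close>

section \<open>Finite and infinite q-Pochhammer products: splitting, nonvanishing,
  boundedness\<close>

lemma qpoch_0 [simp]: "qpoch a q 0 = 1"
  by (simp add: qpoch_def)

lemma qpoch_Suc: "qpoch a q (Suc n) = qpoch a q n * (1 - a * q ^ n)"
  by (simp add: qpoch_def)

lemma qpoch_add: "qpoch a q (m + n) = qpoch a q m * qpoch (a * q ^ m) q n"
  by (induction n) (simp_all add: qpoch_Suc power_add mult.assoc)

lemma qpoch_Suc_left: "qpoch a q (Suc n) = (1 - a) * qpoch (a * q) q n"
  using qpoch_add[of a q 1 n] by (simp add: qpoch_Suc)

lemma qpoch_double: "qpoch a q (2 * n) = qpoch a (q\<^sup>2) n * qpoch (a * q) (q\<^sup>2) n"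
  by (induction n) (simp_all add: qpoch_Suc power_mult [symmetric] algebra_simps)

lemma qpoch_inf_split:
  assumes "norm q < 1"
  shows "qpoch_inf a q = qpoch a q m * qpoch_inf (a * q ^ m) q"
proof (rule LIMSEQ_unique)
  show "(\<lambda>n. qpoch a q (m + n)) \<longlonglongrightarrow> qpoch_inf a q"
    using LIMSEQ_ignore_initial_segment[OF qpoch_LIMSEQ[OF assms], of a m] by (simp add: add.commute)
  show "(\<lambda>n. qpoch a q (m + n)) \<longlonglongrightarrow> qpoch a q m * qpoch_inf (a * q ^ m) q"
    unfolding qpoch_add by (intro tendsto_intros qpoch_LIMSEQ assms)
qed

lemma norm_square_less_1: "norm q < 1 \<Longrightarrow> norm (q\<^sup>2) < 1" for q :: complex
  by (simp add: norm_power power_less_one_iff)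

lemma qpoch_inf_double:
  assumes "norm q < 1"
  shows "qpoch_inf a q = qpoch_inf a (q\<^sup>2) * qpoch_inf (a * q) (q\<^sup>2)"
proof (rule LIMSEQ_unique)
  have "filterlim (\<lambda>n::nat. 2 * n) sequentially sequentially"
    by (intro filterlim_subseq) (simp add: strict_mono_def)
  then show "(\<lambda>n. qpoch a q (2 * n)) \<longlonglongrightarrow> qpoch_inf a q"
    by (rule filterlim_compose[OF qpoch_LIMSEQ[OF assms]])
  show "(\<lambda>n. qpoch a q (2 * n)) \<longlonglongrightarrow> qpoch_inf a (q\<^sup>2) * qpoch_inf (a * q) (q\<^sup>2)"
    unfolding qpoch_double by (intro tendsto_intros qpoch_LIMSEQ norm_square_less_1 assms)
qed

lemma qpoch_nonzero:
  assumes "norm q < 1" "norm a < 1"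
  shows "qpoch a q n \<noteq> 0"
proof -
  have "1 - a * q ^ j \<noteq> 0" for j
  proof
    assume "1 - a * q ^ j = 0"
    then have "norm (a * q ^ j) = 1"
      by simp
    moreover have "norm (a * q ^ j) \<le> norm a * 1"
      unfolding norm_mult norm_power using assms
      by (intro mult_left_mono power_le_one) auto
    ultimately show False
      using assms by simp
  qed
  then show ?thesis
    by (simp add: qpoch_def)
qed

text \<open>Each factor has modulus at most 1 + |q|^j, and the product of these majorants converges.
  Uniformity in \<open>a\<close> matters because the iteration in \<open>fine_false_theta\<close>
  changes \<open>a\<close> at every step.\<close>

lemma qpoch_bounded:
  assumes "norm q < 1"
  obtains C where "\<And>a n. norm a \<le> 1 \<Longrightarrow> norm (qpoch a q n) \<le> C"
proof -
  \<comment> \<open>With this base \<open>qpoch (-1) ?r n\<close> is the product of the 1 + |q|^j,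
    so \<open>qpoch_LIMSEQ\<close> also bounds the majorant.\<close>
  let ?r = "complex_of_real (norm q)"
  have "Bseq (qpoch (-1) ?r)"
    using assms by (intro convergent_imp_Bseq convergentI[OF qpoch_LIMSEQ]) simp
  then obtain C where C: "\<And>n. norm (qpoch (-1) ?r n) \<le> C"
    by (auto simp: Bseq_def)
  have "norm (qpoch a q n) \<le> C" if "norm a \<le> 1" for a n
  proof -
    have "norm (1 - a * q ^ j) \<le> 1 + norm q ^ j" for j
    proof -
      have "norm (1 - a * q ^ j) \<le> 1 + norm a * norm q ^ j"
        using norm_triangle_ineq4[of 1 "a * q ^ j"] by (simp add: norm_mult norm_power)
      also have "\<dots> \<le> 1 + 1 * norm q ^ j"
        using that by (intro add_left_mono mult_right_mono) auto
      finally show ?thesis by simp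
    qed
    then have "norm (qpoch a q n) \<le> (\<Prod>j<n. 1 + norm q ^ j)"
      unfolding qpoch_def prod_norm [symmetric] by (intro prod_mono) auto
    also have "\<dots> = norm (complex_of_real (\<Prod>j<n. 1 + norm q ^ j))"
      by (simp only: norm_of_real) (simp add: prod_nonneg)
    also have "complex_of_real (\<Prod>j<n. 1 + norm q ^ j) = qpoch (-1) ?r n"
      by (simp add: qpoch_def)
    also have "norm \<dots> \<le> C"
      by (rule C)
    finally show ?thesis .
  qed
  then show ?thesis
    using that by blast
qed

section \<open>Euler's expansion of the reciprocal of an infinite product\<close>

lemma summable_norm_euler:
  assumes "norm q < 1" "norm z < 1"
  shows "summable (\<lambda>n. norm (inverse (qpoch q q n) * z ^ n))"
proof (rule abs_summable_in_conv_radius)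
  \<comment> \<open>Consecutive coefficients have a ratio of modulus |1 - q^(n+1)|, which tends to
    1; hence the radius of convergence is 1.\<close>
  have "(\<lambda>n. norm (1 - q * q ^ n)) \<longlonglongrightarrow> norm (1 - q * 0)"
    using assms by (intro tendsto_intros LIMSEQ_power_zero)
  moreover have "norm (inverse (qpoch q q n)) / norm (inverse (qpoch q q (Suc n))) = norm (1 - q * q ^ n)" for n
    using qpoch_nonzero[of q q n] qpoch_nonzero[of q q "Suc n"] assms
    by (simp add: qpoch_Suc norm_mult norm_inverse divide_inverse)
  ultimately have "conv_radius (\<lambda>n. inverse (qpoch q q n)) = 1"
    by (intro conv_radius_ratio_limit_nonzero[where c = 1]) auto
  then show "ereal (norm z) < conv_radius (\<lambda>n. inverse (qpoch q q n))"
    using assms by simp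
qed

text \<open>The series E satisfies (1 - w) E(w) = E(wq). Iteration gives (z;q)_N E(z) = E(z q^N),
  and N to infinity gives (z;q)_inf E(z) = E(0) = 1. This single equation yields both the
  nonvanishing and the value.\<close>

lemma euler_qpoch_inf:
  assumes q: "norm q < 1" and z: "norm z < 1"
  shows "qpoch_inf z q \<noteq> 0"
    and "(\<lambda>n. inverse (qpoch q q n) * z ^ n) sums inverse (qpoch_inf z q)"
proof -
  let ?c = "\<lambda>n. inverse (qpoch q q n)"
  define E where "E = (\<lambda>z. \<Sum>n. ?c n * z ^ n)"
  have sm: "summable (\<lambda>n. ?c n * w ^ n)" if "norm w < 1" for w
    by (rule summable_norm_cancel[OF summable_norm_euler[OF q that]])
  have norm_less: "norm (z * q ^ N) < 1" for N
  proof -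
    have "norm z * norm q ^ N \<le> norm z * 1"
      using q by (intro mult_left_mono power_le_one) auto
    then show ?thesis
      using z by (simp add: norm_mult norm_power)
  qed
  have step: "(1 - w) * E w = E (w * q)" if w: "norm w < 1" for w
  proof -
    have "norm (w * q) < 1"
      using mult_strict_mono'[of "norm w" 1 "norm q" 1] w q by (simp add: norm_mult)
    then have sums: "(\<lambda>n. ?c n * w ^ n) sums E w" "(\<lambda>n. ?c n * (w * q) ^ n) sums E (w * q)"
      unfolding E_def using sm w by (auto intro: summable_sums)
    have "(\<lambda>n. ?c n * w ^ n - ?c n * (w * q) ^ n) sums (E w - E (w * q))"
      using sums by (intro sums_diff)
    \<comment> \<open>The constant terms of the two series cancel, so starting at index 1 leaves the
      sum unchanged.\<close>
    then have "(\<lambda>n. ?c (Suc n) * w ^ Suc n - ?c (Suc n) * (w * q) ^ Suc n) sums (E w - E (w * q))"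
      by (subst sums_Suc_iff) simp
    moreover have "?c (Suc n) * w ^ Suc n - ?c (Suc n) * (w * q) ^ Suc n = w * (?c n * w ^ n)" for n
    proof -
      have "?c (Suc n) * w ^ Suc n - ?c (Suc n) * (w * q) ^ Suc n
          = ?c (Suc n) * (1 - q * q ^ n) * w ^ Suc n"
        by (simp add: power_mult_distrib algebra_simps)
      also have "?c (Suc n) * (1 - q * q ^ n) = ?c n"
        using qpoch_nonzero[OF q q, of "Suc n"] by (auto simp: qpoch_Suc)
      finally show ?thesis by simp
    qed
    ultimately have "(\<lambda>n. w * (?c n * w ^ n)) sums (E w - E (w * q))"
      by simp
    then have "w * E w = E w - E (w * q)"
      using sums_unique2 sums_mult[OF sums(1), of w] by blast
    then show ?thesis
      by (simp add: algebra_simps)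
  qed
  have iter: "qpoch z q N * E z = E (z * q ^ N)" for N
  proof (induction N)
    case (Suc N)
    have "qpoch z q (Suc N) * E z = (1 - z * q ^ N) * (qpoch z q N * E z)"
      by (simp add: qpoch_Suc)
    also have "\<dots> = E (z * q ^ N * q)"
      unfolding Suc.IH by (rule step[OF norm_less])
    finally show ?case
      by (simp add: mult_ac)
  qed simp
  \<comment> \<open>The value 1/2 is just a convenient nonzero point of the open unit disc, where
    the series converges.\<close>
  have "isCont E 0"
    unfolding E_def by (rule isCont_powser[where K = "1/2"]) (rule sm, simp_all)
  moreover have "(\<lambda>N. z * q ^ N) \<longlonglongrightarrow> z * 0"
    using q by (intro tendsto_intros LIMSEQ_power_zero)
  ultimately have "(\<lambda>N. E (z * q ^ N)) \<longlonglongrightarrow> E 0"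
    by (intro isCont_tendsto_compose[of 0 E]) simp_all
  moreover have "E 0 = 1"
    unfolding E_def by (subst powser_zero) simp
  moreover have "(\<lambda>N. E (z * q ^ N)) \<longlonglongrightarrow> qpoch_inf z q * E z"
    unfolding iter [symmetric] by (intro tendsto_intros qpoch_LIMSEQ q)
  ultimately have prod: "qpoch_inf z q * E z = 1"
    using LIMSEQ_unique by metis
  then show "qpoch_inf z q \<noteq> 0"
    by auto
  moreover have "E z = inverse (qpoch_inf z q)"
    using prod by (metis inverse_unique)
  ultimately show "(\<lambda>n. ?c n * z ^ n) sums inverse (qpoch_inf z q)"
    using summable_sums[OF sm[OF z]] by (simp add: E_def)
qed

section \<open>Interchange of summation and reduction of the left-hand side to a Fine series\<close>

lemma sums_swap:
  fixes f :: "nat \<Rightarrow> nat \<Rightarrow> 'a :: banach"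
  assumes bound: "\<And>n m. norm (f n m) \<le> F n * G m"
    and nonneg: "\<And>n. F n \<ge> 0" "\<And>m. G m \<ge> 0"
    and summable: "summable F" "summable G"
    and rows: "\<And>n. f n sums R n" and cols: "\<And>m. (\<lambda>n. f n m) sums C m"
  obtains S where "R sums S" "C sums S"
proof -
  have FG: "F summable_on UNIV" "G summable_on UNIV"
    using nonneg summable by (simp_all add: summable_on_UNIV_nonneg_real_iff)
  \<comment> \<open>The product majorant makes the family absolutely summable over pairs; both
    iterated sums then equal the sum \<open>S\<close> over pairs.\<close>
  have "(\<lambda>(n, m). F n * G m) summable_on UNIV \<times> UNIV"
  proof (rule summable_on_SigmaI)
    show "((\<lambda>m. case (n, m) of (n, m) \<Rightarrow> F n * G m) has_sum F n * infsum G UNIV) UNIV" for n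
      using has_sum_cmult_right[OF has_sum_infsum[OF FG(2)]] by simp
    show "(\<lambda>n. F n * infsum G UNIV) summable_on UNIV"
      by (intro summable_on_cmult_left FG)
  qed (use nonneg in auto)
  then have "(\<lambda>p. norm (case p of (n, m) \<Rightarrow> f n m)) summable_on UNIV \<times> UNIV"
    by (rule Infinite_Sum.abs_summable_on_comparison_test') (use bound in auto)
  then have "(\<lambda>(n, m). f n m) summable_on UNIV \<times> UNIV"
    by (rule abs_summable_summable)
  then obtain S where S: "((\<lambda>(n, m). f n m) has_sum S) (UNIV \<times> UNIV)"
    by (auto simp: summable_on_def)
  \<comment> \<open>Absolute convergence of each row turns the ordered sum in \<open>rows\<close>
    into an unordered one.\<close>
  have "summable (\<lambda>m. norm (f n m))" for n
    by (rule summable_comparison_test'[where g = "\<lambda>m. F n * G m" and N = 0])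
       (use bound in \<open>auto intro: summable_mult summable\<close>)
  then have "(f n has_sum R n) UNIV" for n
    using rows by (rule norm_summable_imp_has_sum)
  then have "(R has_sum S) UNIV"
    by (intro has_sum_SigmaD[OF S]) auto
  have "summable (\<lambda>n. norm (f n m))" for m
    by (rule summable_comparison_test'[where g = "\<lambda>n. F n * G m" and N = 0])
       (use bound in \<open>auto intro: summable_mult2 summable\<close>)
  then have col: "((\<lambda>n. f n m) has_sum C m) UNIV" for m
    using cols by (rule norm_summable_imp_has_sum)
  have "((\<lambda>(m, n). f n m) has_sum S) (UNIV \<times> UNIV)"
    using S by (subst (asm) has_sum_swap) simp
  then have "(C has_sum S) UNIV"
    by (rule has_sum_SigmaD) (simp add: col)
  with \<open>(R has_sum S) UNIV\<close> show ?thesis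
    by (intro that has_sum_imp_sums)
qed

text \<open>Split (q;q)_inf by the parity of the exponents and strip n factors from each half:
  \<open>?O\<close> and \<open>?E\<close> remain, and the stripped factors recombine to (q;q)_2n =
  (q;q)_n (q^(n+1);q)_n. This isolates the reciprocal of \<open>?O\<close>, to which Euler's
  expansion applies.\<close>

lemma lhs_term_eq:
  assumes q: "norm q < 1"
  shows "q ^ n * qpoch (q ^ (n + 1)) q n * qpoch_inf (q ^ (2 * n + 2)) (q\<^sup>2)
    = qpoch_inf q q * (inverse (qpoch q q n) * q ^ n) * inverse (qpoch_inf (q ^ (2 * n + 1)) (q\<^sup>2))"
proof -
  have q2: "norm (q\<^sup>2) < 1"
    by (rule norm_square_less_1[OF q])
  let ?E = "qpoch_inf (q ^ (2 * n + 2)) (q\<^sup>2)" and ?O = "qpoch_inf (q ^ (2 * n + 1)) (q\<^sup>2)"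
  have "norm (q ^ (2 * n + 1)) < 1"
    using q by (simp add: norm_power power_less_one_iff del: power_Suc)
  then have nz: "?O \<noteq> 0" "qpoch q q n \<noteq> 0"
    using euler_qpoch_inf(1) q2 qpoch_nonzero q by blast+
  have odd: "qpoch_inf q (q\<^sup>2) = qpoch q (q\<^sup>2) n * ?O"
    using qpoch_inf_split[OF q2, of q n] by (simp add: power_mult [symmetric])
  have even: "qpoch_inf (q * q) (q\<^sup>2) = qpoch (q * q) (q\<^sup>2) n * ?E"
    using qpoch_inf_split[OF q2, of "q * q" n] by (simp add: power_mult [symmetric] mult.assoc)
  have "qpoch_inf q q = qpoch q q (2 * n) * ?O * ?E"
    unfolding qpoch_inf_double[OF q, of q] odd even qpoch_double by simp
  also have "qpoch q q (2 * n) = qpoch q q n * qpoch (q ^ (n + 1)) q n"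
    using qpoch_add[of q q n n] by (simp add: mult_2)
  finally show ?thesis
    using nz by (simp add: field_simps)
qed

text \<open>The first 2m factors of (q;q)_inf separate by parity into (q;q^2)_m (q^2;q^2)_m. This
  evaluates the column sums of the double series.\<close>

lemma qpoch_inf_odd_quotient:
  assumes q: "norm q < 1"
  shows "qpoch_inf q q * inverse (qpoch (q\<^sup>2) (q\<^sup>2) m) * inverse (qpoch_inf (q ^ (2 * m + 1)) q)
    = qpoch q (q\<^sup>2) m"
proof -
  have q2: "norm (q\<^sup>2) < 1"
    by (rule norm_square_less_1[OF q])
  have "norm (q ^ (2 * m + 1)) < 1"
    using q by (simp add: norm_power power_less_one_iff del: power_Suc)
  then have "qpoch_inf (q ^ (2 * m + 1)) q \<noteq> 0" "qpoch (q\<^sup>2) (q\<^sup>2) m \<noteq> 0"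
    using euler_qpoch_inf(1) q q2 qpoch_nonzero by blast+
  moreover have "qpoch_inf q q = qpoch q (q\<^sup>2) m * qpoch (q\<^sup>2) (q\<^sup>2) m * qpoch_inf (q ^ (2 * m + 1)) q"
    using qpoch_inf_split[OF q, of q "2 * m"] qpoch_double[of q q m] by (simp add: power2_eq_square)
  ultimately show ?thesis
    by (simp add: field_simps)
qed

text \<open>The exponent n + (2n+1)m = n + m + 2nm is symmetric, so the double series is an Euler
  series in either variable: in m with base q^2 and argument q^(2n+1), giving the left-hand summand,
  or in n with base q and argument q^(2m+1), giving the Fine summand.\<close>

lemma lhs_sums_fine:
  assumes q: "norm q < 1" and fine_sums_q: "(\<lambda>m. qpoch q (q\<^sup>2) m * q ^ m) sums S"
  shows "(\<lambda>n. q ^ n * qpoch (q ^ (n + 1)) q n * qpoch_inf (q ^ (2 * n + 2)) (q\<^sup>2)) sums S"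
proof -
  have q2: "norm (q\<^sup>2) < 1"
    by (rule norm_square_less_1[OF q])
  have odd: "norm (q ^ (2 * n + 1)) < 1" for n
    using q by (simp add: norm_power power_less_one_iff del: power_Suc)
  let ?F = "\<lambda>n. inverse (qpoch q q n) * q ^ n"
  let ?G = "\<lambda>m. inverse (qpoch (q\<^sup>2) (q\<^sup>2) m)"
  let ?f = "\<lambda>n m. qpoch_inf q q * ?F n * (?G m * (q ^ (2 * n + 1)) ^ m)"
  obtain T where T:
    "(\<lambda>n. qpoch_inf q q * ?F n * inverse (qpoch_inf (q ^ (2 * n + 1)) (q\<^sup>2))) sums T"
    "(\<lambda>m. qpoch q (q\<^sup>2) m * q ^ m) sums T"
  proof (rule sums_swap[of ?f "\<lambda>n. norm (qpoch_inf q q * ?F n)" "\<lambda>m. norm (?G m * q ^ m)"])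
    fix n m
    \<comment> \<open>Dropping the factor |q|^(2nm) decouples n from m and produces a product
      majorant.\<close>
    have "norm q ^ (2 * n * m) * norm q ^ m \<le> 1 * norm q ^ m"
      using q by (intro mult_right_mono power_le_one) auto
    then have "norm ((q ^ (2 * n + 1)) ^ m) \<le> norm (q ^ m)"
      unfolding norm_power by (simp add: power_mult [symmetric] power_add [symmetric] algebra_simps)
    then show "norm (?f n m) \<le> norm (qpoch_inf q q * ?F n) * norm (?G m * q ^ m)"
      unfolding norm_mult by (intro mult_left_mono) auto
  next
    show "summable (\<lambda>n. norm (qpoch_inf q q * ?F n))"
      unfolding norm_mult[of "qpoch_inf q q"] by (intro summable_mult summable_norm_euler q)
    show "summable (\<lambda>m. norm (?G m * q ^ m))"
      by (rule summable_norm_euler[OF q2 q])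
    show "?f n sums (qpoch_inf q q * ?F n * inverse (qpoch_inf (q ^ (2 * n + 1)) (q\<^sup>2)))" for n
      by (intro sums_mult euler_qpoch_inf(2) q2 odd)
  next
    fix m
    have "(\<lambda>n. qpoch_inf q q * ?G m * q ^ m * (inverse (qpoch q q n) * (q ^ (2 * m + 1)) ^ n))
        sums (qpoch_inf q q * ?G m * q ^ m * inverse (qpoch_inf (q ^ (2 * m + 1)) q))"
      by (intro sums_mult euler_qpoch_inf(2) q odd)
    also have "(\<lambda>n. qpoch_inf q q * ?G m * q ^ m * (inverse (qpoch q q n) * (q ^ (2 * m + 1)) ^ n))
        = (\<lambda>n. ?f n m)"
      by (simp add: fun_eq_iff power_mult [symmetric] power_add [symmetric] algebra_simps)
    also have "qpoch_inf q q * ?G m * q ^ m * inverse (qpoch_inf (q ^ (2 * m + 1)) q)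
        = qpoch q (q\<^sup>2) m * q ^ m"
      unfolding qpoch_inf_odd_quotient[OF q, of m, symmetric] by (simp only: mult_ac)
    finally show "(\<lambda>n. ?f n m) sums (qpoch q (q\<^sup>2) m * q ^ m)" .
  qed auto
  have "T = S"
    by (rule sums_unique2[OF T(2) fine_sums_q])
  then show ?thesis
    using T(1) by (simp only: lhs_term_eq[OF q])
qed

section \<open>Fine series and their iteration to the false theta series\<close>

definition fine_series :: "complex \<Rightarrow> complex \<Rightarrow> complex \<Rightarrow> complex" where
  "fine_series q a t = (\<Sum>n. qpoch a q n * t ^ n)"

text \<open>Termwise comparison with the geometric series C |t|^n. The bound depends only on
  \<open>C\<close> and |t|, as the remainder estimate in \<open>fine_false_theta\<close>
  requires.\<close>

lemma fine_norm_bound: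
  assumes C: "\<And>n. norm (qpoch a q n) \<le> C" and t: "norm t < 1"
  shows "summable (\<lambda>n. qpoch a q n * t ^ n)" and "norm (fine_series q a t) \<le> C / (1 - norm t)"
proof -
  have bound: "norm (qpoch a q n * t ^ n) \<le> C * norm t ^ n" for n
    unfolding norm_mult norm_power by (intro mult_right_mono C) auto
  have geom: "(\<lambda>n. C * norm t ^ n) sums (C * (1 / (1 - norm t)))"
    using t by (intro sums_mult geometric_sums) simp
  have sn: "summable (\<lambda>n. norm (qpoch a q n * t ^ n))"
    by (rule summable_comparison_test'[OF sums_summable[OF geom], of 0]) (use bound in auto)
  then show "summable (\<lambda>n. qpoch a q n * t ^ n)"
    by (rule summable_norm_cancel)
  have "norm (fine_series q a t) \<le> (\<Sum>n. norm (qpoch a q n * t ^ n))"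
    unfolding fine_series_def by (rule summable_norm[OF sn])
  also have "\<dots> \<le> (\<Sum>n. C * norm t ^ n)"
    by (rule suminf_le[OF bound sn sums_summable[OF geom]])
  finally show "norm (fine_series q a t) \<le> C / (1 - norm t)"
    using sums_unique[OF geom] by simp
qed

lemma fine_sums:
  assumes q: "norm q < 1" and t: "norm t < 1"
  shows "(\<lambda>n. qpoch a q n * t ^ n) sums fine_series q a t"
proof -
  have "Bseq (qpoch a q)"
    by (intro convergent_imp_Bseq convergentI[OF qpoch_LIMSEQ[OF q]])
  then obtain C where "\<And>n. norm (qpoch a q n) \<le> C"
    by (auto simp: Bseq_def)
  then show ?thesis
    unfolding fine_series_def using fine_norm_bound(1)[OF _ t] by (intro summable_sums) blast
qed

text \<open>Write F(a,t) for the series. Peeling the last factor of (a;q)_(n+1) gives F(a,t) - 1 = t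
  F(a,t) - a t F(a,tq); peeling the first gives F(a,tq) - 1 = (1-a) t q F(aq,tq). Eliminating
  F(a,tq) proves the relation.\<close>

lemma fine_contiguous:
  assumes q: "norm q < 1" and t: "norm t < 1"
  shows "(1 - t) * fine_series q a t = 1 - a * t * (1 + (1 - a) * (t * q) * fine_series q (a * q) (t * q))"
proof -
  have tq: "norm (t * q) < 1"
    using mult_strict_mono'[of "norm t" 1 "norm q" 1] t q by (simp add: norm_mult)
  have tail: "(\<lambda>n. qpoch a q (Suc n) * s ^ Suc n) sums (fine_series q a s - 1)" if "norm s < 1" for s
    using fine_sums[OF q that, of a] by (subst sums_Suc_iff) simp
  have "(\<lambda>n. t * (qpoch a q n * t ^ n) - a * t * (qpoch a q n * (t * q) ^ n))
      sums (t * fine_series q a t - a * t * fine_series q a (t * q))"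
    by (intro sums_diff sums_mult fine_sums q t tq)
  also have "(\<lambda>n. t * (qpoch a q n * t ^ n) - a * t * (qpoch a q n * (t * q) ^ n))
      = (\<lambda>n. qpoch a q (Suc n) * t ^ Suc n)"
    by (simp add: fun_eq_iff qpoch_Suc power_mult_distrib algebra_simps)
  finally have 1: "fine_series q a t - 1 = t * fine_series q a t - a * t * fine_series q a (t * q)"
    using tail[OF t] sums_unique2 by blast
  have "(\<lambda>n. (1 - a) * (t * q) * (qpoch (a * q) q n * (t * q) ^ n))
      sums ((1 - a) * (t * q) * fine_series q (a * q) (t * q))"
    by (intro sums_mult fine_sums q tq)
  also have "(\<lambda>n. (1 - a) * (t * q) * (qpoch (a * q) q n * (t * q) ^ n))
      = (\<lambda>n. qpoch a q (Suc n) * (t * q) ^ Suc n)"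
    by (simp add: fun_eq_iff qpoch_Suc_left mult_ac)
  finally have "fine_series q a (t * q) - 1 = (1 - a) * (t * q) * fine_series q (a * q) (t * q)"
    using tail[OF tq] sums_unique2 by blast
  then have 2: "1 + (1 - a) * (t * q) * fine_series q (a * q) (t * q) = fine_series q a (t * q)"
    by (simp add: algebra_simps)
  show ?thesis
    unfolding 2 using 1 by (simp add: algebra_simps)
qed

text \<open>In base q^2 the contiguous relation preserves the diagonal a = t. Each step emits 1 +
  q^(2k+1) and multiplies the remainder by -q^(6k+5); these exponents add up to k(3k+2) after k
  steps.\<close>

lemma fine_false_theta:
  assumes q: "norm q < 1"
  shows "(\<lambda>j. (- 1) ^ j * q ^ (j * (3 * j + 2)) * (1 + q ^ (2 * j + 1))) sums fine_series (q\<^sup>2) q q"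
proof -
  have q2: "norm (q\<^sup>2) < 1"
    by (rule norm_square_less_1[OF q])
  define t where "t k = q ^ (2 * k + 1)" for k
  have t_le: "norm (t k) \<le> norm q" for k
    using power_decreasing[of 1 "2 * k + 1" "norm q"] q by (simp add: t_def norm_power del: power_Suc)
  define f where "f k = fine_series (q\<^sup>2) (t k) (t k)" for k
  let ?c = "\<lambda>j. (- 1) ^ j * q ^ (j * (3 * j + 2))"
  have step: "f k = 1 + t k - q ^ (6 * k + 5) * f (Suc k)" for k
  proof -
    have t1: "norm (t k) < 1"
      using t_le[of k] q by simp
    have tS: "t k * q\<^sup>2 = t (Suc k)"
      by (simp add: t_def power_add [symmetric])
    have "(1 - t k) * f k = 1 - t k * t k * (1 + (1 - t k) * t (Suc k) * f (Suc k))"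
      using fine_contiguous[OF q2 t1, of "t k"] by (simp add: f_def tS)
    \<comment> \<open>On the diagonal the factor 1 - \<open>t k\<close> divides both 1 -
      (\<open>t k\<close>)^2 and the remainder, so it cancels.\<close>
    also have "\<dots> = (1 - t k) * (1 + t k - t k * t k * t (Suc k) * f (Suc k))"
      by (simp add: algebra_simps)
    also have "t k * t k * t (Suc k) = q ^ (6 * k + 5)"
      unfolding t_def power_add [symmetric] by (rule arg_cong[where f = "power q"]) simp
    finally show ?thesis
      using t1 by auto
  qed
  have iter: "f 0 = (\<Sum>j<k. ?c j * (1 + t j)) + ?c k * f k" for k
  proof (induction k)
    case (Suc k)
    have "q ^ (k * (3 * k + 2)) * q ^ (6 * k + 5) = q ^ (Suc k * (3 * Suc k + 2))"
      unfolding power_add [symmetric] by (rule arg_cong[where f = "power q"]) (simp add: algebra_simps)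
    then have "?c k * f k = ?c k * (1 + t k) + ?c (Suc k) * f (Suc k)"
      unfolding step[of k] by (simp add: algebra_simps)
    then show ?case
      using Suc.IH by simp
  qed simp
  obtain C where C: "\<And>a n. norm a \<le> 1 \<Longrightarrow> norm (qpoch a (q\<^sup>2) n) \<le> C"
    using qpoch_bounded[OF q2] by blast
  have "C \<ge> 0"
    using C[of 0 0] by simp
  \<comment> \<open>Since |\<open>t k\<close>| never exceeds |q|, the \<open>f k\<close> are
    uniformly bounded, and the remainder decays because k(3k+2) is at least k.\<close>
  have "norm (?c k * f k) \<le> norm q ^ k * (C / (1 - norm q))" for k
  proof -
    have "norm (f k) \<le> C / (1 - norm (t k))"
      unfolding f_def using t_le[of k] q by (intro fine_norm_bound C) auto
    also have "\<dots> \<le> C / (1 - norm q)"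
      using t_le[of k] q \<open>C \<ge> 0\<close> by (intro divide_left_mono mult_pos_pos) auto
    finally have "norm (f k) \<le> C / (1 - norm q)" .
    moreover have "norm (?c k) \<le> norm q ^ k"
      using power_decreasing[of k "k * (3 * k + 2)" "norm q"] q by (simp add: norm_mult norm_power)
    ultimately show ?thesis
      unfolding norm_mult[of "?c k"] by (intro mult_mono) auto
  qed
  moreover have "(\<lambda>k. norm q ^ k * (C / (1 - norm q))) \<longlonglongrightarrow> 0"
    using q by (intro tendsto_mult_left_zero LIMSEQ_power_zero) simp
  ultimately have "(\<lambda>k. ?c k * f k) \<longlonglongrightarrow> 0"
    by (rule Lim_null_comparison[OF always_eventually[OF allI]])
  then have "(\<lambda>k. f 0 - ?c k * f k) \<longlonglongrightarrow> f 0 - 0"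
    by (intro tendsto_intros)
  moreover have "f 0 - ?c k * f k = (\<Sum>j<k. ?c j * (1 + t j))" for k
    using iter[of k] by (simp add: algebra_simps)
  ultimately have "(\<lambda>j. ?c j * (1 + t j)) sums f 0"
    by (simp add: sums_def)
  then show ?thesis
    by (simp add: f_def t_def)
qed

theorem theorem5p3:
  fixes q :: complex
  assumes "norm q < 1"
  shows "summable (\<lambda>n. q ^ n * qpoch (q ^ (n + 1)) q n * qpoch_inf (q ^ (2 * n + 2)) (q\<^sup>2))
    \<and> summable (\<lambda>j. (- 1) ^ j * q ^ (j * (3 * j + 2)) * (1 + q ^ (2 * j + 1)))
    \<and> (\<Sum>n. q ^ n * qpoch (q ^ (n + 1)) q n * qpoch_inf (q ^ (2 * n + 2)) (q\<^sup>2))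
      = (\<Sum>j. (- 1) ^ j * q ^ (j * (3 * j + 2)) * (1 + q ^ (2 * j + 1)))"
  using lhs_sums_fine[OF assms fine_sums[OF norm_square_less_1[OF assms] assms]] fine_false_theta[OF assms]
  by (auto simp only: sums_iff)

end
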